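(* Let $n\ge 3$ be an integer which is not a power of $2$. Then $\Gamma_{NCC}(D_{2n})$ is always a cograph and a chordal graph, but it is neither a split graph nor a threshold graph when $n$ is even and $\frac{n}{2}$ is odd.
   Context: $D_{2n}=\langle x,y\mid x^n=y^2=1,\ yxy^{-1}=x^{-1}\rangle$ is the dihedral group of order $2n$. For a finite group $G$, the nilpotent conjugacy class graph $\Gamma_{NCC}(G)$ is the simple graph whose vertices are the non-central conjugacy classes of $G$ (the classes $x^G$ with $x\notin Z(G)$), two distinct vertices $x^G$ and $y^G$ being adjacent if and only if there exist $a\in x^G$ and $b\in y^G$ such that $\langle a,b\rangle$ is nilpotent. In terms of forbidden induced subgraphs: a graph is a cograph if it has no induced $P_4$ (path on four vertices); chordal if it has no induced cycle $C_m$ with $m\ge4$; split if it has no induced $C_4$, $C_5$ or $2K_2$; threshold if it has no induced $2K_2$, $C_4$ or $P_4$. *)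

theory Defs
  imports "HOL-Algebra.Algebra" "Graph_Theory.Graph_Theory"
begin

section \<open>Groups given by generators and relations\<close>

text \<open>
  A word over a type of generators is a list of letters; \<open>(g, True)\<close> stands for the generator
  \<open>g\<close> and \<open>(g, False)\<close> for its formal inverse. A relation \<open>l = r\<close> is the pair \<open>(l, r)\<close> of words.
  The presented group consists of the classes of words modulo the least congruence that
  contains the given relations and the free cancellations.
\<close>

type_synonym 'g word = "('g \<times> bool) list"

inductive word_equiv :: "('g word \<times> 'g word) set \<Rightarrow> 'g word \<Rightarrow> 'g word \<Rightarrow> bool"
  for R where
  refl: "word_equiv R w w"
| sym: "word_equiv R v w \<Longrightarrow> word_equiv R w v"
| trans: "word_equiv R u v \<Longrightarrow> word_equiv R v w \<Longrightarrow> word_equiv R u w"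
| cancel: "word_equiv R (u @ [(g, b), (g, \<not> b)] @ v) (u @ v)"
| relation: "(l, r) \<in> R \<Longrightarrow> word_equiv R (u @ l @ v) (u @ r @ v)"

definition word_class :: "('g word \<times> 'g word) set \<Rightarrow> 'g word \<Rightarrow> 'g word set" where
  "word_class R w = {v. word_equiv R w v}"

definition presented_group :: "('g word \<times> 'g word) set \<Rightarrow> 'g word set monoid" where
  "presented_group R =
    \<lparr>carrier = range (word_class R),
     monoid.mult = (\<lambda>A B. \<Union>a\<in>A. \<Union>b\<in>B. word_class R (a @ b)),
     one = word_class R []\<rparr>"

lemma word_equiv_context:
  "word_equiv R v w \<Longrightarrow> word_equiv R (a @ v @ b) (a @ w @ b)"
proof (induction rule: word_equiv.induct)
  case (cancel u g c v)
  show ?case using word_equiv.cancel[of R "a @ u" g c "v @ b"] by simp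
next
  case (relation l r u v)
  then show ?case using word_equiv.relation[of l r R "a @ u" "v @ b"] by simp
next
  case (refl w)
  show ?case by (rule word_equiv.refl)
next
  case (sym v w)
  show ?case by (rule word_equiv.sym[OF sym.IH])
next
  case (trans u v w)
  show ?case by (rule word_equiv.trans[OF trans.IH])
qed

lemma word_class_eq_iff: "word_class R v = word_class R w \<longleftrightarrow> word_equiv R v w"
proof
  assume "word_class R v = word_class R w"
  moreover have "w \<in> word_class R w" by (simp add: word_class_def word_equiv.refl)
  ultimately have "w \<in> word_class R v" by (simp only:)
  then show "word_equiv R v w" by (simp add: word_class_def)
next
  assume vw: "word_equiv R v w"
  have "word_equiv R v u \<longleftrightarrow> word_equiv R w u" for u
  proof
    show "word_equiv R w u" if "word_equiv R v u"
      by (rule word_equiv.trans[OF word_equiv.sym[OF vw] that])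
    show "word_equiv R v u" if "word_equiv R w u"
      by (rule word_equiv.trans[OF vw that])
  qed
  then show "word_class R v = word_class R w" by (simp add: word_class_def)
qed

lemma presented_group_mult:
  "word_class R v \<otimes>\<^bsub>presented_group R\<^esub> word_class R w = word_class R (v @ w)"
proof -
  have "word_class R (a @ b) = word_class R (v @ w)"
    if "a \<in> word_class R v" "b \<in> word_class R w" for a b
  proof -
    from that have "word_equiv R v a" "word_equiv R w b" by (simp_all add: word_class_def)
    then have "word_equiv R (v @ w) (a @ w)" "word_equiv R (a @ w) (a @ b)"
      using word_equiv_context[of R v a "[]" w] word_equiv_context[of R w b a "[]"] by simp_all
    then have "word_class R (v @ w) = word_class R (a @ w)"
      "word_class R (a @ w) = word_class R (a @ b)"
      by (simp_all only: word_class_eq_iff)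
    then show ?thesis by simp
  qed
  then have "(\<Union>a\<in>word_class R v. \<Union>b\<in>word_class R w. word_class R (a @ b))
      = (\<Union>a\<in>word_class R v. \<Union>b\<in>word_class R w. word_class R (v @ w))"
    by (intro SUP_cong HOL.refl)
  also have "\<dots> = word_class R (v @ w)"
  proof -
    have "v \<in> word_class R v" "w \<in> word_class R w"
      by (simp_all add: word_class_def word_equiv.refl)
    then have "word_class R v \<noteq> {}" "word_class R w \<noteq> {}" by auto
    then show ?thesis by simp
  qed
  finally show ?thesis by (simp add: presented_group_def)
qed

lemma word_equiv_inverse:
  "word_equiv R (map (\<lambda>(g, b). (g, \<not> b)) (rev w) @ w) []"
proof (induction w)
  case (Cons p w)
  obtain g b where p: "p = (g, b)" by fastforce
  show ?case
    unfolding p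
    by (rule word_equiv.trans[OF _ Cons.IH])
      (use word_equiv.cancel[of R "map (\<lambda>(g, b). (g, \<not> b)) (rev w)" g "\<not> b" w] in simp)
qed (simp add: word_equiv.refl)

lemma carrier_presented_group: "carrier (presented_group R) = range (word_class R)"
  by (simp add: presented_group_def)

lemma one_presented_group: "\<one>\<^bsub>presented_group R\<^esub> = word_class R []"
  by (simp add: presented_group_def)

lemma group_presented_group: "group (presented_group R)"
proof (rule groupI, unfold carrier_presented_group one_presented_group)
  fix A assume "A \<in> range (word_class R)"
  then obtain w where w: "A = word_class R w" by (rule rangeE)
  show "word_class R [] \<otimes>\<^bsub>presented_group R\<^esub> A = A"
    by (simp only: w presented_group_mult append_Nil)
  have "word_class R (map (\<lambda>(g, b). (g, \<not> b)) (rev w)) \<otimes>\<^bsub>presented_group R\<^esub> A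
      = word_class R []"
    by (simp only: w presented_group_mult word_class_eq_iff word_equiv_inverse)
  then show "\<exists>B\<in>range (word_class R). B \<otimes>\<^bsub>presented_group R\<^esub> A = word_class R []"
    by (rule bexI[OF _ rangeI])
next
  fix A B assume "A \<in> range (word_class R)" "B \<in> range (word_class R)"
  then obtain v w where "A = word_class R v" "B = word_class R w" by (elim rangeE)
  then show "A \<otimes>\<^bsub>presented_group R\<^esub> B \<in> range (word_class R)"
    by (simp only: presented_group_mult rangeI)
next
  fix A B C
  assume "A \<in> range (word_class R)" "B \<in> range (word_class R)" "C \<in> range (word_class R)"
  then obtain u v w where "A = word_class R u" "B = word_class R v" "C = word_class R w"
    by (elim rangeE)
  then show "A \<otimes>\<^bsub>presented_group R\<^esub> B \<otimes>\<^bsub>presented_group R\<^esub> C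
      = A \<otimes>\<^bsub>presented_group R\<^esub> (B \<otimes>\<^bsub>presented_group R\<^esub> C)"
    by (simp only: presented_group_mult append_assoc)
qed (rule rangeI)


section \<open>The dihedral group\<close>

datatype dihedral_gen = Gen_x | Gen_y

text \<open>\<open>dihedral_group n\<close> is $D_{2n}$, the dihedral group of order $2n$ (not of order $n$).\<close>

definition dihedral_group :: "nat \<Rightarrow> dihedral_gen word set monoid" where
  "dihedral_group n = presented_group
    {(replicate n (Gen_x, True), []),
     (replicate 2 (Gen_y, True), []),
     ([(Gen_y, True), (Gen_x, True), (Gen_y, False)], [(Gen_x, False)])}"


section \<open>Centre, conjugacy classes and nilpotency\<close>

definition group_centre :: "('a, 'b) monoid_scheme \<Rightarrow> 'a set" where
  "group_centre G = {z \<in> carrier G. \<forall>g\<in>carrier G. z \<otimes>\<^bsub>G\<^esub> g = g \<otimes>\<^bsub>G\<^esub> z}"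

definition conj_class :: "('a, 'b) monoid_scheme \<Rightarrow> 'a \<Rightarrow> 'a set" where
  "conj_class G x = {g \<otimes>\<^bsub>G\<^esub> x \<otimes>\<^bsub>G\<^esub> inv\<^bsub>G\<^esub> g | g. g \<in> carrier G}"

definition commutator_subgroup :: "('a, 'b) monoid_scheme \<Rightarrow> 'a set \<Rightarrow> 'a set \<Rightarrow> 'a set" where
  "commutator_subgroup G H K =
    generate G {h \<otimes>\<^bsub>G\<^esub> k \<otimes>\<^bsub>G\<^esub> inv\<^bsub>G\<^esub> h \<otimes>\<^bsub>G\<^esub> inv\<^bsub>G\<^esub> k | h k. h \<in> H \<and> k \<in> K}"

primrec lower_central_series :: "('a, 'b) monoid_scheme \<Rightarrow> nat \<Rightarrow> 'a set" where
  "lower_central_series G 0 = carrier G"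
| "lower_central_series G (Suc i) =
    commutator_subgroup G (lower_central_series G i) (carrier G)"

definition nilpotent_group :: "('a, 'b) monoid_scheme \<Rightarrow> bool" where
  "nilpotent_group G \<longleftrightarrow> group G \<and> (\<exists>c. lower_central_series G c = {\<one>\<^bsub>G\<^esub>})"


section \<open>The nilpotent conjugacy class graph\<close>

text \<open>
  As usual in \<^theory>\<open>Graph_Theory.Graph_Theory\<close>, a simple graph is a loop-free symmetric digraph:
  an edge \<open>{u, v}\<close> is represented by the two arcs \<open>(u, v)\<close> and \<open>(v, u)\<close>.
\<close>

definition noncentral_classes :: "('a, 'b) monoid_scheme \<Rightarrow> 'a set set" where
  "noncentral_classes G = conj_class G ` (carrier G - group_centre G)"

definition NCC_graph :: "('a, 'b) monoid_scheme \<Rightarrow> 'a set pair_pre_digraph" where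
  "NCC_graph G =
    \<lparr>pverts = noncentral_classes G,
     parcs = {(C, D). C \<in> noncentral_classes G \<and> D \<in> noncentral_classes G \<and> C \<noteq> D \<and>
       (\<exists>a\<in>C. \<exists>b\<in>D. nilpotent_group (subgroup_generated G {a, b}))}\<rparr>"

lemma pair_bidirected_NCC_graph: "pair_bidirected_digraph (NCC_graph G)"
proof
  show "symmetric (NCC_graph G)"
    unfolding symmetric_def
  proof (rule symI)
    fix C D assume "(C, D) \<in> arcs_ends (NCC_graph G)"
    then obtain a b where "C \<in> noncentral_classes G" "D \<in> noncentral_classes G" "C \<noteq> D"
      "a \<in> C" "b \<in> D" "nilpotent_group (subgroup_generated G {b, a})"
      by (auto simp: NCC_graph_def insert_commute)
    then show "(D, C) \<in> arcs_ends (NCC_graph G)"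
      unfolding NCC_graph_def by simp blast
  qed
qed (auto simp: NCC_graph_def)


section \<open>Graph classes defined by forbidden induced subgraphs\<close>

text \<open>
  \<^const>\<open>induced_subgraph\<close> requires the host graph to be well-formed, so \<open>has_induced\<close> is
  meaningful for well-formed \<open>G\<close> only; for \<^const>\<open>NCC_graph\<close> see \<open>pair_bidirected_NCC_graph\<close>.
\<close>

definition has_induced :: "('a, 'b) pre_digraph \<Rightarrow> ('c, 'd) pre_digraph \<Rightarrow> bool" where
  "has_induced G F \<longleftrightarrow> (\<exists>H. induced_subgraph H G \<and> digraph_iso F H)"

definition path_graph :: "nat \<Rightarrow> nat pair_pre_digraph" where
  "path_graph m =
    \<lparr>pverts = {..<m},
     parcs = {(i, j). i < m \<and> j < m \<and> (j = Suc i \<or> i = Suc j)}\<rparr>"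

text \<open>The cycle of length \<open>m\<close>; a simple graph only for \<open>m \<ge> 3\<close>.\<close>

definition cycle_graph :: "nat \<Rightarrow> nat pair_pre_digraph" where
  "cycle_graph m =
    \<lparr>pverts = {..<m},
     parcs = {(i, j). i < m \<and> j < m \<and> (j = Suc i mod m \<or> i = Suc j mod m)}\<rparr>"

definition two_K2 :: "nat pair_pre_digraph" where
  "two_K2 = \<lparr>pverts = {..<4}, parcs = {(0, 1), (1, 0), (2, 3), (3, 2)}\<rparr>"

definition cograph :: "('a, 'b) pre_digraph \<Rightarrow> bool" where
  "cograph G \<longleftrightarrow> \<not> has_induced G (path_graph 4)"

definition chordal :: "('a, 'b) pre_digraph \<Rightarrow> bool" where
  "chordal G \<longleftrightarrow> (\<forall>m\<ge>4. \<not> has_induced G (cycle_graph m))"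

definition split_graph :: "('a, 'b) pre_digraph \<Rightarrow> bool" where
  "split_graph G \<longleftrightarrow> \<not> has_induced G (cycle_graph 4) \<and>
    \<not> has_induced G (cycle_graph 5) \<and> \<not> has_induced G two_K2"

definition threshold_graph :: "('a, 'b) pre_digraph \<Rightarrow> bool" where
  "threshold_graph G \<longleftrightarrow> \<not> has_induced G two_K2 \<and>
    \<not> has_induced G (cycle_graph 4) \<and> \<not> has_induced G (path_graph 4)"

end

theory Submission
  imports Defs "HOL-Number_Theory.Cong"
begin

text \<open>
  Write the elements of the dihedral group as rotations \<open>x\<^sup>i\<close> and reflections \<open>x\<^sup>i y\<close>. Two
  rotations commute. A rotation \<open>x\<^sup>i\<close> and a reflection generate a dihedral group whose lower
  central series continues with the subgroups generated by \<open>x\<close> to the powers \<open>2i, 4i, 8i, \<dots>\<close>,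
  so it is nilpotent exactly if the order of \<open>x\<^sup>i\<close> is a power of 2. There are at most two
  classes of reflections, told apart by the parity of the exponent; if \<open>n = 2\<^sup>a m\<close> with
  \<open>m\<close> odd, then \<open>x\<^sup>i y\<close> and \<open>x\<^bsup>i + m\<^esup> y\<close> have different parity and generate a dihedral
  2-group, so these classes are adjacent.

  Hence the only missing edges join the classes of rotations whose order is not a power of 2 to
  the classes of reflections, and all of these are missing: the complement of the graph is
  complete bipartite up to isolated vertices. An induced path on 4 vertices and an induced cycle
  of length at least 4 both contain vertices 0, 1, 2, 3 with edges 01, 12 and non-edges 02, 13.
  The non-edge 02 puts 0 and 2 on opposite sides of the bipartition, and 13 puts 1 on one of the
  sides, so 1 is not adjacent to both 0 and 2. This contradiction
  (\<open>no_path4_or_cycle_if_nonadjacency_bipartite\<close>) makes the graph a cograph and chordal.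

  If \<open>n = 2m\<close> with \<open>m \<ge> 3\<close> odd, then \<open>x\<close> and \<open>x\<^sup>2\<close> have the orders \<open>n\<close> and \<open>m\<close>, which
  are not powers of 2. Their two classes and the two classes of reflections then induce \<open>2K\<^sub>2\<close>
  (\<open>has_induced_two_K2_NCC_graph\<close>), which excludes split and threshold graphs.

  All of this is calculation with exponents modulo \<open>n\<close>. Apart from the multiplication table of
  rotations and reflections, the presentation enters only through the fact that \<open>x\<close> has order exactly \<open>n\<close>, which is read off from an action of words on the integers
  modulo \<open>n\<close> (\<open>word_equiv_imp_word_action_cong\<close>).
\<close>

section \<open>Induced subgraphs of graphs without parallel arcs\<close>

text \<open>
  Between graphs whose arcs are pairs of vertices, an isomorphism onto an induced subgraph is
  determined by its vertex map. This lemma and the next replace the four components of a digraph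
  isomorphism by a single injection that preserves and reflects arcs.
\<close>

lemma has_induced_pairD:
  fixes G :: "'a pair_pre_digraph" and F :: "'b pair_pre_digraph"
  assumes "has_induced G F"
  obtains f where "inj_on f (pverts F)" "f ` pverts F \<subseteq> pverts G"
    "\<And>u v. u \<in> pverts F \<Longrightarrow> v \<in> pverts F \<Longrightarrow> (f u, f v) \<in> parcs G \<longleftrightarrow> (u, v) \<in> parcs F"
proof -
  from assms obtain H where H: "induced_subgraph H G" and "digraph_iso F H"
    by (auto simp: has_induced_def)
  then obtain h where h: "pre_digraph.digraph_isomorphism F h" and H_eq: "H = app_iso h F"
    by (auto simp: digraph_iso_def)
  let ?f = "iso_verts h"
  have inj: "inj_on ?f (pverts F)" and wf: "wf_digraph (with_proj F)"
    and ends: "\<And>e. e \<in> parcs F \<Longrightarrow>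
      ?f (fst e) = iso_tail h (iso_arcs h e) \<and> ?f (snd e) = iso_head h (iso_arcs h e)"
    using h by (auto simp: pre_digraph.digraph_isomorphism_def)
  have sub: "?f ` pverts F \<subseteq> pverts G" and proj: "iso_tail h = fst" "iso_head h = snd"
    and arcs: "iso_arcs h ` parcs F
      = {e \<in> parcs G. fst e \<in> ?f ` pverts F \<and> snd e \<in> ?f ` pverts F}"
    using H by (auto simp: H_eq induced_subgraph_def subgraph_def compatible_def)
  have arc_image: "iso_arcs h (u, v) = (?f u, ?f v)" if "(u, v) \<in> parcs F" for u v
    using ends[OF that] by (simp add: proj prod_eq_iff)
  have "(?f u, ?f v) \<in> parcs G \<longleftrightarrow> (u, v) \<in> parcs F" if uv: "u \<in> pverts F" "v \<in> pverts F" for u v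
  proof
    assume "(u, v) \<in> parcs F"
    then have "iso_arcs h (u, v) \<in> iso_arcs h ` parcs F" by (rule imageI)
    then show "(?f u, ?f v) \<in> parcs G"
      unfolding arcs using arc_image[OF \<open>(u, v) \<in> parcs F\<close>] by simp
  next
    assume "(?f u, ?f v) \<in> parcs G"
    then have "(?f u, ?f v) \<in> iso_arcs h ` parcs F"
      unfolding arcs using uv by simp
    then obtain u' v' where e: "(u', v') \<in> parcs F" "(?f u, ?f v) = iso_arcs h (u', v')"
      by auto
    moreover have "u' \<in> pverts F" "v' \<in> pverts F"
      using wf e(1) by (auto simp: wf_digraph_def)
    ultimately show "(u, v) \<in> parcs F"
      using arc_image[OF e(1)] inj_onD[OF inj _ uv(1)] inj_onD[OF inj _ uv(2)] by auto
  qed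
  with inj sub show thesis by (rule that)
qed

lemma has_induced_pairI:
  fixes G :: "'a pair_pre_digraph" and F :: "'b pair_pre_digraph"
  assumes "pair_wf_digraph G" "pair_wf_digraph F"
    and inj: "inj_on f (pverts F)" and sub: "f ` pverts F \<subseteq> pverts G"
    and arcs: "\<And>u v. u \<in> pverts F \<Longrightarrow> v \<in> pverts F \<Longrightarrow> (f u, f v) \<in> parcs G \<longleftrightarrow> (u, v) \<in> parcs F"
  shows "has_induced G F"
proof -
  interpret F: pair_wf_digraph F by fact
  define h where "h = \<lparr>iso_verts = f, iso_arcs = map_prod f f, iso_head = snd, iso_tail = fst\<rparr>"
  have F_arcs: "parcs F \<subseteq> pverts F \<times> pverts F"
    using F.in_arcsD1 F.in_arcsD2 by auto
  have "inj_on (map_prod f f) (parcs F)"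
    using map_prod_inj_on[OF inj inj] F_arcs by (rule inj_on_subset)
  then have iso: "pre_digraph.digraph_isomorphism F h"
    using inj assms(2)
    by (simp add: pre_digraph.digraph_isomorphism_def h_def wf_digraph_wp_iff)
  have "map_prod f f ` parcs F = {e \<in> parcs G. fst e \<in> f ` pverts F \<and> snd e \<in> f ` pverts F}"
  proof (intro Set.set_eqI iffI)
    fix e assume "e \<in> map_prod f f ` parcs F"
    then show "e \<in> {e \<in> parcs G. fst e \<in> f ` pverts F \<and> snd e \<in> f ` pverts F}"
      using F_arcs arcs by fastforce
  next
    fix e assume "e \<in> {e \<in> parcs G. fst e \<in> f ` pverts F \<and> snd e \<in> f ` pverts F}"
    then obtain u v where uv: "u \<in> pverts F" "v \<in> pverts F" "e = (f u, f v)" "e \<in> parcs G"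
      by (cases e) auto
    then have "(u, v) \<in> parcs F" using arcs by simp
    then show "e \<in> map_prod f f ` parcs F" using uv(3) by force
  qed
  moreover have "wf_digraph (app_iso h F)"
    using F.wf_digraphI_app_iso[OF iso] .
  ultimately have "induced_subgraph (app_iso h F) G"
    using sub assms(1)
    by (auto simp: induced_subgraph_def subgraph_def compatible_def h_def wf_digraph_wp_iff)
  with iso show ?thesis
    unfolding has_induced_def digraph_iso_def by blast
qed

text \<open>
  The four vertices 0, 1, 2, 3 with edges 01, 12 and non-edges 02, 13 occur in the path on four
  vertices and in every cycle of length at least 4. In such a copy the vertex 1 would lie in
  \<open>A\<close> or in \<open>B\<close>, but one of its neighbours 0 and 2 lies on the opposite side.
\<close>

lemma no_path4_or_cycle_if_nonadjacency_bipartite: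
  fixes G :: "'a pair_pre_digraph"
  assumes nonadjacent: "\<And>u v. u \<in> pverts G \<Longrightarrow> v \<in> pverts G \<Longrightarrow> u \<noteq> v \<Longrightarrow> (u, v) \<notin> parcs G
      \<Longrightarrow> u \<in> A \<and> v \<in> B \<or> u \<in> B \<and> v \<in> A"
    and sides: "\<And>u v. u \<in> A \<Longrightarrow> v \<in> B \<Longrightarrow> (u, v) \<notin> parcs G \<and> (v, u) \<notin> parcs G"
  shows "cograph G" "chordal G"
proof -
  have no_copy: "\<not> has_induced G F"
    if F: "{0, 1, 2, 3} \<subseteq> pverts F" "(0, 1) \<in> parcs F" "(1, 2) \<in> parcs F"
      "(0, 2) \<notin> parcs F" "(1, 3) \<notin> parcs F" for F :: "nat pair_pre_digraph"
  proof
    assume "has_induced G F"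
    then obtain f where f: "inj_on f (pverts F)" "f ` pverts F \<subseteq> pverts G"
      "\<And>u v. u \<in> pverts F \<Longrightarrow> v \<in> pverts F \<Longrightarrow> (f u, f v) \<in> parcs G \<longleftrightarrow> (u, v) \<in> parcs F"
      by (rule has_induced_pairD) blast
    have "f 0 \<noteq> f 2" "f 1 \<noteq> f 3" using inj_onD[OF f(1)] F(1) by fastforce+
    then have "f 0 \<in> A \<and> f 2 \<in> B \<or> f 0 \<in> B \<and> f 2 \<in> A" "f 1 \<in> A \<or> f 1 \<in> B"
      using nonadjacent[of "f 0" "f 2"] nonadjacent[of "f 1" "f 3"] f(2,3) F by auto
    moreover have "(f 0, f 1) \<in> parcs G" "(f 1, f 2) \<in> parcs G" using f(3) F by auto
    ultimately show False using sides by blast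
  qed
  show "cograph G"
    unfolding cograph_def by (rule no_copy) (auto simp: path_graph_def)
  \<comment> \<open>The edges of the cycle that wrap around avoid the pairs 02 and 13.\<close>
  have "3 mod m \<noteq> 0" "Suc 0 \<noteq> 4 mod m" if "4 \<le> m" for m :: nat
    using that by (cases "m = 4"; simp)+
  then show "chordal G"
    unfolding chordal_def
    by (intro allI impI no_copy) (auto simp: cycle_graph_def)
qed

section \<open>Nilpotency of generated subgroups\<close>

text \<open>
  The lower central series descends at least as fast as any central series. The series
  \<open>N\<close> consists of subgroups of the ambient group, and \<open>N 0\<close> need only contain the generators,
  so that the generated subgroup does not have to be determined.
\<close>

lemma (in group) nilpotent_subgroup_generatedI:
  assumes S: "S \<subseteq> N 0" and N: "\<And>i. subgroup (N i) G"
    and commutator: "\<And>i h k. h \<in> N i \<Longrightarrow> k \<in> N 0 \<Longrightarrow> h \<otimes> k \<otimes> inv h \<otimes> inv k \<in> N (Suc i)"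
    and trivial: "N c = {\<one>}"
  shows "nilpotent_group (subgroup_generated G S)"
proof -
  let ?K = "subgroup_generated G S"
  interpret K: group ?K by (rule group_subgroup_generated)
  have K0: "carrier ?K \<subseteq> N 0" by (rule subgroup_generated_minimal[OF N S])
  have series: "subgroup (lower_central_series ?K i) ?K \<and> lower_central_series ?K i \<subseteq> N i" for i
  proof (induction i)
    case 0
    show ?case using K0 K.subgroup_self by simp
  next
    case (Suc i)
    let ?L = "lower_central_series ?K i"
    let ?C = "{h \<otimes>\<^bsub>?K\<^esub> k \<otimes>\<^bsub>?K\<^esub> inv\<^bsub>?K\<^esub> h \<otimes>\<^bsub>?K\<^esub> inv\<^bsub>?K\<^esub> k |h k. h \<in> ?L \<and> k \<in> carrier ?K}"
    have L: "?L \<subseteq> carrier ?K" using Suc.IH subgroup.subset by blast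
    have C: "?C \<subseteq> carrier ?K" using L by (blast intro: K.m_closed K.inv_closed)
    have "?C \<subseteq> N (Suc i)"
    proof
      fix z assume "z \<in> ?C"
      then obtain h k where hk: "h \<in> ?L" "k \<in> carrier ?K"
        and z: "z = h \<otimes>\<^bsub>?K\<^esub> k \<otimes>\<^bsub>?K\<^esub> inv\<^bsub>?K\<^esub> h \<otimes>\<^bsub>?K\<^esub> inv\<^bsub>?K\<^esub> k" by blast
      have "z = h \<otimes> k \<otimes> inv h \<otimes> inv k" using z hk L by (simp add: subset_iff)
      then show "z \<in> N (Suc i)" using commutator[of h i k] hk Suc.IH K0 by blast
    qed
    then have "carrier ?K \<inter> ?C \<subseteq> carrier ?K \<inter> N (Suc i)" by blast
    moreover have "subgroup (carrier ?K \<inter> N (Suc i)) ?K"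
      using N subgroup_subgroup_generated
      by (simp add: subgroup_subgroup_generated_iff subgroups_Inter_pair)
    ultimately have "generate ?K ?C \<subseteq> carrier ?K \<inter> N (Suc i)"
      using C by (intro K.generate_subgroup_incl) auto
    then show ?case
      using K.generate_is_subgroup[OF C] by (simp add: commutator_subgroup_def)
  qed
  have "lower_central_series ?K c = {\<one>\<^bsub>?K\<^esub>}"
    using series[of c] trivial subgroup.one_closed[of "lower_central_series ?K c" ?K] by auto
  then show ?thesis unfolding nilpotent_group_def using K.is_group by blast
qed

section \<open>The elements of a dihedral group\<close>

text \<open>
  The defining relations of order two and inversion already give the multiplication table of the
  elements \<open>x\<^sup>i\<close> and \<open>x\<^sup>i y\<close>. Keeping the order of \<open>x\<close> and the generation of the group apart
  lets the table be used to show that a group consists of these elements.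
\<close>

locale dihedral_pair = group G for G (structure) +
  fixes x y :: 'a
  assumes x_closed [simp]: "x \<in> carrier G" and y_closed [simp]: "y \<in> carrier G"
    and y_square: "y \<otimes> y = \<one>"
    and y_conj_x: "y \<otimes> x \<otimes> inv y = inv x"
begin

definition rot :: "int \<Rightarrow> 'a" where "rot i = x [^] i"

definition ref :: "int \<Rightarrow> 'a" where "ref i = x [^] i \<otimes> y"

lemma rot_closed [simp]: "rot i \<in> carrier G" and ref_closed [simp]: "ref i \<in> carrier G"
  by (simp_all add: rot_def ref_def)

lemma rot_zero: "rot 0 = \<one>"
  by (simp add: rot_def)

lemma rot_rot [simp]: "rot i \<otimes> rot j = rot (i + j)"
  by (simp add: rot_def int_pow_mult)

lemma rot_ref [simp]: "rot i \<otimes> ref j = ref (i + j)"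
  by (simp add: rot_def ref_def int_pow_mult m_assoc)

lemma inv_y: "inv y = y"
  using y_square by (simp add: inv_equality)

text \<open>Conjugation by \<open>y\<close> is a homomorphism that inverts \<open>x\<close>, hence it inverts its powers.\<close>

lemma y_rot: "y \<otimes> rot i = ref (- i)"
proof -
  have hom: "(\<lambda>g. y \<otimes> g \<otimes> inv y) \<in> hom G G"
    by (intro homI) (simp_all add: m_assoc inv_solve_left)
  interpret c: group_hom G G "\<lambda>g. y \<otimes> g \<otimes> inv y"
    by unfold_locales (rule hom)
  have "y \<otimes> rot i \<otimes> inv y = inv x [^] i"
    using c.hom_int_pow[of x i] by (simp add: rot_def y_conj_x)
  also have "\<dots> = rot (- i)" by (simp add: rot_def int_pow_inv int_pow_neg)
  finally have "y \<otimes> rot i = rot (- i) \<otimes> y" using inv_solve_right'[of "rot (- i)" "y \<otimes> rot i" y] by simp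
  then show ?thesis by (simp add: rot_def ref_def)
qed

lemma ref_rot [simp]: "ref i \<otimes> rot j = ref (i - j)"
proof -
  have "ref i \<otimes> rot j = rot i \<otimes> (y \<otimes> rot j)"
    by (simp add: ref_def rot_def m_assoc)
  then show ?thesis by (simp add: y_rot)
qed

lemma ref_ref [simp]: "ref i \<otimes> ref j = rot (i - j)"
proof -
  have "ref i \<otimes> ref j = ref i \<otimes> rot j \<otimes> y" by (simp add: ref_def rot_def m_assoc)
  also have "\<dots> = rot (i - j) \<otimes> (y \<otimes> y)"
    unfolding ref_rot by (simp add: ref_def rot_def m_assoc)
  finally show ?thesis by (simp add: y_square)
qed

lemma inv_rot [simp]: "inv (rot i) = rot (- i)"
  by (rule inv_equality) (simp_all add: rot_zero)

lemma inv_ref [simp]: "inv (ref i) = ref i"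
  by (rule inv_equality) (simp_all add: rot_zero)

end

locale dihedral = dihedral_pair +
  fixes n :: nat
  assumes n_pos: "n > 0"
    and rot_eq_one_iff: "rot i = \<one> \<longleftrightarrow> int n dvd i"
    and carrier_eq: "carrier G = range rot \<union> range ref"
begin

lemma rot_eq_iff: "rot i = rot j \<longleftrightarrow> int n dvd i - j"
proof -
  have "rot i = rot j \<longleftrightarrow> rot i \<otimes> rot (- j) = \<one>"
    using inv_solve_right[of \<one> "rot i" "rot j"] by auto
  then show ?thesis by (simp add: rot_eq_one_iff)
qed

lemma ref_eq_iff: "ref i = ref j \<longleftrightarrow> int n dvd i - j"
proof -
  have "ref i = ref j \<longleftrightarrow> rot i = rot j"
    using r_cancel[of "rot i" y "rot j"] by (auto simp: rot_def ref_def)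
  then show ?thesis by (simp add: rot_eq_iff)
qed

lemma conj_class_rot: "conj_class G (rot i) = {rot i, rot (- i)}"
proof -
  have "conj_class G (rot i) = (\<lambda>g. g \<otimes> rot i \<otimes> inv g) ` carrier G"
    by (auto simp: conj_class_def)
  then show ?thesis unfolding carrier_eq by (auto simp: image_Un image_image)
qed

lemma conj_class_ref: "conj_class G (ref i) = range (\<lambda>k. ref (i + 2 * k))"
proof -
  have "conj_class G (ref i) = (\<lambda>g. g \<otimes> ref i \<otimes> inv g) ` carrier G"
    by (auto simp: conj_class_def)
  also have "\<dots> = range (\<lambda>k. ref (i + 2 * k)) \<union> range (\<lambda>k. ref (2 * k - i))"
    unfolding carrier_eq image_Un image_image by (simp add: algebra_simps)
  also have "\<dots> = range (\<lambda>k. ref (i + 2 * k))"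
  proof -
    have "ref (2 * k - i) \<in> range (\<lambda>k. ref (i + 2 * k))" for k
      by (rule range_eqI[of _ _ "k - i"]) (simp add: algebra_simps)
    then show ?thesis by auto
  qed
  finally show ?thesis .
qed

section \<open>Nilpotent subgroups of a dihedral group\<close>

text \<open>
  These are the elements of the subgroup generated by \<open>rot d\<close> and \<open>ref j\<close>. Both
  pairs of generators that matter below lie in such subgroups, \<open>rot d\<close> and \<open>ref j\<close> as well as
  \<open>ref j\<close> and \<open>ref (j + d)\<close>.
\<close>

definition dihedral_subset :: "int \<Rightarrow> int \<Rightarrow> 'a set" where
  "dihedral_subset d j = range (\<lambda>k. rot (d * k)) \<union> range (\<lambda>k. ref (j + d * k))"

lemma subgroup_rot_multiples: "subgroup (range (\<lambda>k. rot (d * k))) G"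
proof (rule subgroupI)
  fix a b assume "a \<in> range (\<lambda>k. rot (d * k))" "b \<in> range (\<lambda>k. rot (d * k))"
  then obtain k l where "a = rot (d * k)" "b = rot (d * l)" by auto
  then show "inv a \<in> range (\<lambda>k. rot (d * k))" "a \<otimes> b \<in> range (\<lambda>k. rot (d * k))"
    by (auto simp flip: distrib_left mult_minus_right)
qed auto

lemma subgroup_dihedral_subset: "subgroup (dihedral_subset d j) G"
proof (rule subgroupI)
  show "dihedral_subset d j \<subseteq> carrier G" "dihedral_subset d j \<noteq> {}"
    by (auto simp: dihedral_subset_def)
next
  fix a assume "a \<in> dihedral_subset d j"
  then show "inv a \<in> dihedral_subset d j"
    by (auto simp: dihedral_subset_def simp flip: mult_minus_right)
next
  have "rot (d * k) \<otimes> ref (j + d * l) = ref (j + d * (k + l))"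
    "ref (j + d * k) \<otimes> rot (d * l) = ref (j + d * (k - l))"
    "rot (d * k) \<otimes> rot (d * l) = rot (d * (k + l))"
    "ref (j + d * k) \<otimes> ref (j + d * l) = rot (d * (k - l))" for k l
    by (simp_all add: algebra_simps)
  moreover fix a b assume "a \<in> dihedral_subset d j" "b \<in> dihedral_subset d j"
  ultimately show "a \<otimes> b \<in> dihedral_subset d j"
    unfolding dihedral_subset_def by auto
qed

text \<open>
  Every commutator of \<open>dihedral_subset d j\<close> is a rotation by a multiple of \<open>2d\<close>, and a
  commutator of a rotation with any element rotates by 0 or twice as far in either direction.
  So the rotations by multiples of \<open>2d, 4d, 8d, \<dots>\<close> form a central series.
\<close>

lemma nilpotent_in_dihedral_subset:
  assumes ord: "rot (d * 2 ^ c) = \<one>" and S: "S \<subseteq> dihedral_subset d j"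
  shows "nilpotent_group (subgroup_generated G S)"
proof -
  define N where "N i = (if i = 0 then dihedral_subset d j else range (\<lambda>k. rot (d * 2 ^ i * k)))"
    for i :: nat
  show ?thesis
  proof (rule nilpotent_subgroup_generatedI)
    show "S \<subseteq> N 0" using S by (simp add: N_def)
    show "subgroup (N i) G" for i
      by (simp add: N_def subgroup_rot_multiples subgroup_dihedral_subset)
    \<comment> \<open>The series is taken up to \<open>Suc c\<close> since for \<open>c = 0\<close> the term \<open>N c\<close> still contains reflections.\<close>
    have "int n dvd d * 2 ^ c" using ord by (simp add: rot_eq_one_iff)
    then have "int n dvd d * 2 ^ c * (2 * k)" for k by (rule dvd_mult2)
    then have "rot (d * 2 ^ Suc c * k) = \<one>" for k
      unfolding rot_eq_one_iff power_Suc by (metis mult.assoc mult.commute)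
    then show "N (Suc c) = {\<one>}" by (auto simp: N_def)
  next
    have commutators:
      "rot a \<otimes> rot b \<otimes> inv (rot a) \<otimes> inv (rot b) = rot 0"
      "rot a \<otimes> ref b \<otimes> inv (rot a) \<otimes> inv (ref b) = rot (2 * a)"
      "ref a \<otimes> rot b \<otimes> inv (ref a) \<otimes> inv (rot b) = rot (2 * - b)"
      "ref a \<otimes> ref b \<otimes> inv (ref a) \<otimes> inv (ref b) = rot (2 * (a - b))" for a b
      by simp_all
    have N0: "N 0 = dihedral_subset d j" by (simp add: N_def)
    have multiple: "rot (2 * (d * 2 ^ i * k)) \<in> N (Suc i)" "rot 0 \<in> N (Suc i)"
      "rot (2 * (d * k)) \<in> N (Suc 0)" for i k
      by (auto simp: N_def ac_simps intro: range_eqI[of _ _ k] range_eqI[of _ _ 0])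
    fix i h k assume h: "h \<in> N i" and k: "k \<in> N 0"
    show "h \<otimes> k \<otimes> inv h \<otimes> inv k \<in> N (Suc i)"
    proof (cases i)
      case 0
      have "rot (2 * - (d * b)) \<in> N (Suc 0)" "rot (2 * ((j + d * a) - (j + d * b))) \<in> N (Suc 0)"
        for a b
        using multiple(3)[of "- b"] multiple(3)[of "a - b"] by (simp_all add: algebra_simps)
      then show ?thesis
        using h k multiple(2)[of 0] multiple(3) unfolding 0 N0 dihedral_subset_def
        by (auto simp: commutators simp del: inv_rot inv_ref rot_rot ref_rot rot_ref ref_ref)
    next
      case (Suc i')
      then show ?thesis
        using h k multiple[of i]
        by (auto simp: N_def dihedral_subset_def commutators simp del: inv_rot inv_ref rot_rot
            ref_rot rot_ref ref_ref)
    qed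
  qed
qed


lemma nilpotent_rotations: "nilpotent_group (subgroup_generated G {rot i, rot j})"
proof (rule nilpotent_subgroup_generatedI)
  define N where "N k = (if k = 0 then range rot else {\<one>})" for k :: nat
  show "{rot i, rot j} \<subseteq> N 0" "N 1 = {\<one>}" by (auto simp: N_def)
  show "subgroup (N k) G" for k
    using subgroup_rot_multiples[of 1] by (simp add: N_def triv_subgroup)
  show "h \<otimes> g \<otimes> inv h \<otimes> inv g \<in> N (Suc k)" if "h \<in> N k" "g \<in> N 0" for k h g
    using that by (auto simp: N_def rot_zero simp flip: rot_zero split: if_splits)
qed

text \<open>
  The commutator of a rotation with a reflection rotates by twice the angle, so
  \<open>rot (i * 2 ^ k)\<close> survives in the
  \<open>k\<close>-th term of the lower central series. It is trivial for some \<open>k\<close> exactly if the order of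
  \<open>rot i\<close> is a power of 2.
\<close>

lemma nilpotent_rot_ref_iff:
  "nilpotent_group (subgroup_generated G {rot i, ref j}) \<longleftrightarrow> (\<exists>c. rot (i * 2 ^ c) = \<one>)"
proof
  assume "\<exists>c. rot (i * 2 ^ c) = \<one>"
  moreover have "{rot i, ref j} \<subseteq> dihedral_subset i j"
    by (auto simp: dihedral_subset_def intro: range_eqI[of _ _ 0] range_eqI[of _ _ 1])
  ultimately show "nilpotent_group (subgroup_generated G {rot i, ref j})"
    using nilpotent_in_dihedral_subset by blast
next
  let ?K = "subgroup_generated G {rot i, ref j}"
  assume "nilpotent_group ?K"
  then obtain c where c: "lower_central_series ?K c = {\<one>\<^bsub>?K\<^esub>}"
    by (auto simp: nilpotent_group_def)
  have K: "rot i \<in> carrier ?K" "ref j \<in> carrier ?K"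
    using subgroup_generated_subset_carrier_subset[of "{rot i, ref j}"] by auto
  have "rot (i * 2 ^ k) \<in> lower_central_series ?K k \<and> rot (i * 2 ^ k) \<in> carrier ?K" for k
  proof (induction k)
    case 0
    show ?case using K by simp
  next
    case (Suc k)
    let ?r = "rot (i * 2 ^ k)"
    have "?r \<otimes>\<^bsub>?K\<^esub> ref j \<otimes>\<^bsub>?K\<^esub> inv\<^bsub>?K\<^esub> ?r \<otimes>\<^bsub>?K\<^esub> inv\<^bsub>?K\<^esub> ref j = rot (i * 2 ^ Suc k)"
      using Suc.IH K by (simp add: algebra_simps)
    then have "rot (i * 2 ^ Suc k) \<in> lower_central_series ?K (Suc k)"
      unfolding lower_central_series.simps commutator_subgroup_def
      using Suc.IH K(2) by (intro generate.incl CollectI exI[of _ ?r] exI[of _ "ref j"]) simp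
    moreover have "?r \<otimes>\<^bsub>?K\<^esub> ?r \<in> carrier ?K"
      using Suc.IH by (intro monoid.m_closed[OF group.is_monoid[OF group_subgroup_generated]]) auto
    then have "rot (i * 2 ^ Suc k) \<in> carrier ?K" by (simp add: algebra_simps)
    ultimately show ?case by blast
  qed
  from this[of c] show "\<exists>c. rot (i * 2 ^ c) = \<one>" unfolding c by auto
qed

section \<open>The nilpotent conjugacy class graph of a dihedral group\<close>

abbreviation adjacent :: "'a set \<Rightarrow> 'a set \<Rightarrow> bool" where
  "adjacent C D \<equiv> (C, D) \<in> parcs (NCC_graph G)"

lemma adjacent_iff:
  "adjacent C D \<longleftrightarrow> C \<in> noncentral_classes G \<and> D \<in> noncentral_classes G \<and> C \<noteq> D \<and>
     (\<exists>a\<in>C. \<exists>b\<in>D. nilpotent_group (subgroup_generated G {a, b}))"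
  by (simp add: NCC_graph_def)

lemma adjacent_commute: "adjacent C D \<longleftrightarrow> adjacent D C"
proof -
  have "(\<exists>a\<in>C. \<exists>b\<in>D. nilpotent_group (subgroup_generated G {a, b}))
      \<longleftrightarrow> (\<exists>b\<in>D. \<exists>a\<in>C. nilpotent_group (subgroup_generated G {b, a}))"
    by (metis insert_commute)
  then show ?thesis unfolding adjacent_iff by blast
qed

lemma noncentral_class_cases:
  assumes "C \<in> noncentral_classes G"
  obtains (rot) i where "C = conj_class G (rot i)" | (ref) i where "C = conj_class G (ref i)"
  using assms unfolding noncentral_classes_def carrier_eq by auto

lemma rot_classes_adjacent:
  assumes "conj_class G (rot i) \<in> noncentral_classes G" "conj_class G (rot j) \<in> noncentral_classes G"
    and "conj_class G (rot i) \<noteq> conj_class G (rot j)"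
  shows "adjacent (conj_class G (rot i)) (conj_class G (rot j))"
  using assms nilpotent_rotations[of i j] unfolding adjacent_iff by (auto simp: conj_class_rot)

lemma ref_class_eq:
  assumes "even (i - j)"
  shows "conj_class G (ref i) = conj_class G (ref j)"
proof -
  from assms obtain t where "i - j = 2 * t" by (rule evenE)
  then have i: "i = j + 2 * t" by simp
  have "ref (j + 2 * t + 2 * k) \<in> range (\<lambda>k. ref (j + 2 * k))" for k
    by (rule range_eqI[of _ _ "k + t"]) (simp add: algebra_simps)
  moreover have "ref (j + 2 * k) \<in> range (\<lambda>k. ref (j + 2 * t + 2 * k))" for k
    by (rule range_eqI[of _ _ "k - t"]) (simp add: algebra_simps)
  ultimately show ?thesis unfolding conj_class_ref i by blast
qed

text \<open>
  The representative of the second class has to be chosen well: \<open>ref i\<close> and \<open>ref (i + m)\<close>, with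
  \<open>m\<close> the odd part of \<open>n\<close>, generate a subgroup whose rotations have 2-power order, whereas
  \<open>ref i\<close> and \<open>ref (i + 1)\<close> generate the whole group.
\<close>

lemma ref_classes_adjacent:
  assumes "conj_class G (ref i) \<in> noncentral_classes G" "conj_class G (ref j) \<in> noncentral_classes G"
    and "conj_class G (ref i) \<noteq> conj_class G (ref j)"
  shows "adjacent (conj_class G (ref i)) (conj_class G (ref j))"
proof -
  obtain m where m: "n = 2 ^ multiplicity 2 n * m" "odd m"
    using multiplicity_decompose'[of n 2] n_pos by auto
  have "odd (i - j)" using assms(3) ref_class_eq by blast
  then have "even ((i + int m) - j)" using m(2) by simp
  then have "conj_class G (ref (i + int m)) = conj_class G (ref j)" by (rule ref_class_eq)
  moreover have "ref (i + int m) \<in> conj_class G (ref (i + int m))"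
    unfolding conj_class_ref by (auto intro: range_eqI[of _ _ 0])
  ultimately have j: "ref (i + int m) \<in> conj_class G (ref j)" by simp
  have "int n = int m * 2 ^ multiplicity 2 n"
    using arg_cong[OF m(1), of int] by (simp add: mult.commute)
  then have "rot (int m * 2 ^ multiplicity 2 n) = \<one>"
    by (simp add: rot_eq_one_iff)
  moreover have "{ref i, ref (i + int m)} \<subseteq> dihedral_subset (int m) i"
    by (auto simp: dihedral_subset_def intro: range_eqI[of _ _ 0] range_eqI[of _ _ 1])
  ultimately have "nilpotent_group (subgroup_generated G {ref i, ref (i + int m)})"
    by (rule nilpotent_in_dihedral_subset)
  moreover have "ref i \<in> conj_class G (ref i)"
    unfolding conj_class_ref by (auto intro: range_eqI[of _ _ 0])
  ultimately show ?thesis using assms j unfolding adjacent_iff by blast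
qed

text \<open>
  The representatives do not matter here, since conjugates of a rotation have the same order.
\<close>

lemma rot_ref_classes_adjacent_iff:
  assumes "conj_class G (rot i) \<in> noncentral_classes G" "conj_class G (ref j) \<in> noncentral_classes G"
    and "conj_class G (rot i) \<noteq> conj_class G (ref j)"
  shows "adjacent (conj_class G (rot i)) (conj_class G (ref j)) \<longleftrightarrow> (\<exists>c. rot (i * 2 ^ c) = \<one>)"
proof -
  have "rot (- i * 2 ^ c) = \<one> \<longleftrightarrow> rot (i * 2 ^ c) = \<one>" for c by (simp add: rot_eq_one_iff)
  then show ?thesis
    using assms by (simp add: adjacent_iff conj_class_rot conj_class_ref nilpotent_rot_ref_iff)
qed

theorem cograph_NCC_graph: "cograph (NCC_graph G)"
  and chordal_NCC_graph: "chordal (NCC_graph G)"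
proof -
  define A where "A = {conj_class G (rot i) |i. \<forall>c. rot (i * 2 ^ c) \<noteq> \<one>}"
  define B where "B = range (\<lambda>j. conj_class G (ref j))"
  have sides: "\<not> adjacent C D \<and> \<not> adjacent D C" if CD: "C \<in> A" "D \<in> B" for C D
  proof -
    obtain i j where "C = conj_class G (rot i)" "\<forall>c. rot (i * 2 ^ c) \<noteq> \<one>" "D = conj_class G (ref j)"
      using CD by (auto simp: A_def B_def)
    then have "\<not> adjacent C D"
      using rot_ref_classes_adjacent_iff[of i j] adjacent_iff[of C D] by blast
    then show ?thesis using adjacent_commute by blast
  qed
  have nonadjacent: "C \<in> A \<and> D \<in> B \<or> C \<in> B \<and> D \<in> A"
    if CD: "C \<in> noncentral_classes G" "D \<in> noncentral_classes G" "C \<noteq> D" "\<not> adjacent C D" for C D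
    using CD(1)
  proof (cases rule: noncentral_class_cases)
    case C: (rot i)
    from CD(2) show ?thesis
    proof (cases rule: noncentral_class_cases)
      case (rot j)
      with C CD rot_classes_adjacent show ?thesis by blast
    next
      case (ref j)
      with C CD rot_ref_classes_adjacent_iff[of i j] show ?thesis
        unfolding A_def B_def by blast
    qed
  next
    case C: (ref i)
    from CD(2) show ?thesis
    proof (cases rule: noncentral_class_cases)
      case (rot j)
      with C CD rot_ref_classes_adjacent_iff[of j i] adjacent_commute[of C D] show ?thesis
        unfolding A_def B_def by blast
    next
      case (ref j)
      with C CD ref_classes_adjacent show ?thesis by blast
    qed
  qed
  have verts: "pverts (NCC_graph G) = noncentral_classes G" by (simp add: NCC_graph_def)
  show "cograph (NCC_graph G)" "chordal (NCC_graph G)"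
    using no_path4_or_cycle_if_nonadjacency_bipartite[of "NCC_graph G" A B]
      nonadjacent sides unfolding verts by blast+
qed

text \<open>A rotation that equals a reflection would centralise and invert \<open>x\<close>, so \<open>n\<close> would divide 2.\<close>

lemma rot_neq_ref:
  assumes "n \<ge> 3"
  shows "rot i \<noteq> ref j"
proof
  assume eq: "rot i = ref j"
  have "rot (i + 1) = ref (j - 1)" using arg_cong[OF eq, of "\<lambda>g. g \<otimes> rot 1"] by simp
  also have "\<dots> = rot (i - 1)" using arg_cong[OF eq, of "\<lambda>g. rot (- 1) \<otimes> g"] by simp
  finally have "rot (i + 1) \<otimes> rot (1 - i) = rot (i - 1) \<otimes> rot (1 - i)" by simp
  then have "int n dvd 2" using rot_eq_one_iff[of 2] by (simp add: rot_zero)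
  then show False using assms zdvd_imp_le[of "int n" 2] by simp
qed

text \<open>
  The two edges join the classes of \<open>rot 1\<close> and \<open>rot 2\<close>, and the two classes of reflections.
  No edge runs between them because the orders \<open>n\<close> and \<open>n div 2\<close> of \<open>rot 1\<close> and \<open>rot 2\<close> are
  divisible by \<open>n div 2\<close>, which is odd and at least 3.
\<close>

lemma has_induced_two_K2_NCC_graph:
  assumes n: "n \<ge> 3" "even n" "odd (n div 2)"
  shows "has_induced (NCC_graph G) two_K2"
proof -
  from n have n6: "n \<ge> 6" by presburger
  have small: "\<not> int n dvd k" if "0 < \<bar>k\<bar>" "\<bar>k\<bar> < 6" for k
    using that n6 dvd_imp_le_int[of k "int n"] by auto
  \<comment> \<open>The exponents 2 and 3 stand for an even and an odd one, so these are the two classes of reflections.\<close>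
  define f :: "nat \<Rightarrow> 'a set" where
    "f i = (if i < 2 then conj_class G (rot (int i + 1)) else conj_class G (ref (int i)))" for i
  have noncentral: "conj_class G (rot k) \<in> noncentral_classes G" if "k = 1 \<or> k = 2" for k
  proof -
    have "ref k \<noteq> ref (- k)"
      using small[of "k + k"] that by (auto simp: ref_eq_iff)
    then have "rot k \<otimes> ref 0 \<noteq> ref 0 \<otimes> rot k" by simp
    then have "rot k \<notin> group_centre G" unfolding group_centre_def using ref_closed by blast
    then show ?thesis by (auto simp: noncentral_classes_def)
  qed
  have noncentral_ref: "conj_class G (ref k) \<in> noncentral_classes G" for k
  proof -
    have "ref (k + 1) \<noteq> ref (k - 1)"
      using small[of 2] by (simp add: ref_eq_iff)
    then have "ref k \<otimes> rot 1 \<noteq> rot 1 \<otimes> ref k" by (simp add: add.commute)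
    then have "ref k \<notin> group_centre G" unfolding group_centre_def using rot_closed by blast
    then show ?thesis by (auto simp: noncentral_classes_def)
  qed
  have mem: "rot k \<in> conj_class G (rot k)" "ref k \<in> conj_class G (ref k)" for k
    unfolding conj_class_rot conj_class_ref by (auto intro: range_eqI[of _ _ 0])
  have rot_ref_neq: "conj_class G (rot i) \<noteq> conj_class G (ref j)" for i j
    using mem(1)[of i] rot_neq_ref[OF n(1)] unfolding conj_class_ref by auto
  have rots_neq: "conj_class G (rot 1) \<noteq> conj_class G (rot 2)"
  proof -
    have "rot 2 \<notin> conj_class G (rot 1)"
      using small[of 1] small[of 3] by (simp add: conj_class_rot rot_eq_iff)
    then show ?thesis using mem(1)[of 2] by metis
  qed
  have refs_neq: "conj_class G (ref 2) \<noteq> conj_class G (ref 3)"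
  proof
    assume "conj_class G (ref 2) = conj_class G (ref 3)"
    then have "ref 3 \<in> conj_class G (ref 2)" using mem(2)[of 3] by metis
    then obtain k where "ref 3 = ref (2 + 2 * k)" unfolding conj_class_ref by (rule rangeE)
    then have "int n dvd 3 - (2 + 2 * k)" by (simp only: ref_eq_iff)
    moreover have "2 dvd int n" using n(2) by simp
    ultimately have "2 dvd 3 - (2 + 2 * k)" using dvd_trans[of 2 "int n"] by blast
    then show False by presburger
  qed
  have not_two_power: "rot (k * 2 ^ c) \<noteq> \<one>" if "k = 1 \<or> k = 2" for k c
  proof
    assume "rot (k * 2 ^ c) = \<one>"
    moreover have "k * 2 ^ c dvd 2 ^ Suc c" using that by auto
    ultimately have "int n dvd int (2 ^ Suc c)"
      using dvd_trans[of "int n"] by (simp add: rot_eq_one_iff)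
    then have "n dvd 2 ^ Suc c" by (simp only: of_nat_dvd_iff)
    moreover have "n div 2 dvd n" using dvd_triv_left[of "n div 2" 2] n(2) by simp
    ultimately have "n div 2 dvd 2 ^ Suc c" by (rule dvd_trans[rotated])
    moreover have "coprime (n div 2) (2 ^ Suc c)"
      using n(3) by (metis coprime_power_right_iff coprime_right_2_iff_odd)
    ultimately have "n div 2 dvd 1" using coprime_absorb_left by blast
    then show False using n6 by simp
  qed
  have not_adj: "\<not> adjacent (conj_class G (rot k)) (conj_class G (ref j))"
    "\<not> adjacent (conj_class G (ref j)) (conj_class G (rot k))" if "k = 1 \<or> k = 2" for k j
    using rot_ref_classes_adjacent_iff[OF noncentral[OF that] noncentral_ref rot_ref_neq, of j]
      not_two_power[OF that] adjacent_commute[of "conj_class G (ref j)"] by simp_all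
  have adj: "adjacent (conj_class G (rot 1)) (conj_class G (rot 2))"
    "adjacent (conj_class G (ref 2)) (conj_class G (ref 3))"
    using rot_classes_adjacent ref_classes_adjacent noncentral noncentral_ref rots_neq refs_neq
    by auto
  note adj_sym = adj[THEN iffD1[OF adjacent_commute]]
  have no_loop: "\<not> adjacent C C" for C by (simp add: adjacent_iff)
  have four: "{..<4} = {0, 1, 2, 3 :: nat}" by auto
  have f: "f 0 = conj_class G (rot 1)" "f (Suc 0) = conj_class G (rot 2)"
    "f 2 = conj_class G (ref 2)" "f 3 = conj_class G (ref 3)" by (simp_all add: f_def)
  show ?thesis
  proof (rule has_induced_pairI[where f = f])
    show "pair_wf_digraph (NCC_graph G)"
      using pair_bidirected_NCC_graph[of G]
      by (simp add: pair_bidirected_digraph_def pair_loopfree_digraph_def)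
    show "pair_wf_digraph two_K2" by unfold_locales (auto simp: two_K2_def)
    show "inj_on f (pverts two_K2)"
      unfolding two_K2_def by (simp add: four f rot_ref_neq rot_ref_neq[symmetric] rots_neq
          rots_neq[symmetric] refs_neq refs_neq[symmetric])
    show "f ` pverts two_K2 \<subseteq> pverts (NCC_graph G)"
      unfolding two_K2_def by (simp add: four f noncentral noncentral_ref NCC_graph_def)
    show "adjacent (f u) (f v) \<longleftrightarrow> (u, v) \<in> parcs two_K2"
      if "u \<in> pverts two_K2" "v \<in> pverts two_K2" for u v
    proof -
      have "u \<in> {0, Suc 0, 2, 3}" "v \<in> {0, Suc 0, 2, 3}"
        using that by (simp_all add: two_K2_def four)
      then show ?thesis
        unfolding two_K2_def insert_iff empty_iff
        by (elim disjE) (simp_all add: f adj adj_sym not_adj no_loop)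
    qed
  qed
qed

end

section \<open>The presented group is dihedral\<close>

text \<open>
  Words act on the integers, with \<open>x\<close> as the translation by 1 and \<open>y\<close> as the reflection at 0.
  Modulo \<open>n\<close> this is the action on the vertices of the regular \<open>n\<close>-gon, so the relations hold
  there; since \<open>x\<close> to the power \<open>m\<close> moves 0 to \<open>m\<close>, the order of \<open>x\<close> is not smaller than \<open>n\<close>.
\<close>

fun gen_action :: "dihedral_gen \<times> bool \<Rightarrow> int \<Rightarrow> int" where
  "gen_action (Gen_x, b) k = (if b then k + 1 else k - 1)"
| "gen_action (Gen_y, b) k = - k"

definition word_action :: "dihedral_gen word \<Rightarrow> int \<Rightarrow> int" where
  "word_action w = foldr gen_action w"

lemma word_action_append: "word_action (u @ v) k = word_action u (word_action v k)"
  by (simp add: word_action_def)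

lemma word_action_cong:
  assumes "[k = l] (mod m)"
  shows "[word_action w k = word_action w l] (mod m)"
proof (induction w)
  case (Cons p w)
  obtain g b where "p = (g, b)" by fastforce
  with Cons show ?case
    unfolding word_action_def by (cases g) (auto intro: cong_add cong_diff simp: cong_minus_minus_iff)
qed (use assms in \<open>simp add: word_action_def\<close>)

lemma word_action_x_power: "word_action (replicate m (Gen_x, True)) k = k + int m"
  by (induction m) (simp_all add: word_action_def)

definition dihedral_relations :: "nat \<Rightarrow> (dihedral_gen word \<times> dihedral_gen word) set" where
  "dihedral_relations n =
    {(replicate n (Gen_x, True), []),
     (replicate 2 (Gen_y, True), []),
     ([(Gen_y, True), (Gen_x, True), (Gen_y, False)], [(Gen_x, False)])}"

lemma word_equiv_imp_word_action_cong:
  assumes "word_equiv (dihedral_relations n) v w"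
  shows "[word_action v k = word_action w k] (mod int n)"
  using assms
proof (induction arbitrary: k)
  case (refl w)
  show ?case by simp
next
  case (sym v w)
  then show ?case by (simp add: cong_sym)
next
  case (trans u v w)
  then show ?case using cong_trans by blast
next
  case (cancel u g b v)
  have "word_action [(g, b), (g, \<not> b)] l = l" for l
    by (cases g; cases b) (simp_all add: word_action_def)
  then show ?case by (simp add: word_action_append del: append_Cons)
next
  case (relation l r u v)
  have "[word_action l j = word_action r j] (mod int n)" for j
    using relation unfolding dihedral_relations_def
    by (auto simp: word_action_x_power numeral_2_eq_2) (simp_all add: word_action_def cong_def)
  then show ?case by (simp add: word_action_append word_action_cong)
qed

text \<open>
  The order of \<open>x\<close> divides \<open>n\<close> by the first relation and is a multiple of \<open>n\<close> by the action on the
  \<open>n\<close>-gon. Every word is a product of letters, and the multiplication table shows that rotations and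
  reflections are closed under products.
\<close>

lemma dihedral_dihedral_group:
  assumes "n > 0"
  shows "dihedral (dihedral_group n) (word_class (dihedral_relations n) [(Gen_x, True)])
    (word_class (dihedral_relations n) [(Gen_y, True)]) n"
proof -
  let ?c = "word_class (dihedral_relations n)"
  let ?X = "?c [(Gen_x, True)]" and ?Y = "?c [(Gen_y, True)]"
  let ?G = "dihedral_group n"
  have G: "?G = presented_group (dihedral_relations n)"
    by (simp add: dihedral_group_def dihedral_relations_def)
  interpret group ?G unfolding G by (rule group_presented_group)
  note mult = presented_group_mult[of "dihedral_relations n", folded G]
  note one = one_presented_group[of "dihedral_relations n", folded G]
  have closed: "?c w \<in> carrier ?G" for w by (simp add: G carrier_presented_group)
  have relation: "?c l = ?c r" if "(l, r) \<in> dihedral_relations n" for l r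
    using word_equiv.relation[OF that, of "[]" "[]"] by (simp add: word_class_eq_iff)
  have cancel: "?c [(g, b), (g, \<not> b)] = ?c []" for g b
    using word_equiv.cancel[of "dihedral_relations n" "[]" g b "[]"] by (simp add: word_class_eq_iff)
  have inverse: "inv\<^bsub>?G\<^esub> (?c [(g, b)]) = ?c [(g, \<not> b)]" for g b
    using cancel[of g "\<not> b"] by (intro inv_equality) (simp_all add: mult one closed)
  have power: "?X [^]\<^bsub>?G\<^esub> m = ?c (replicate m (Gen_x, True))" for m :: nat
    by (induction m) (simp_all add: one mult flip: replicate_append_same)
  have "?X [^]\<^bsub>?G\<^esub> n = \<one>\<^bsub>?G\<^esub>"
    unfolding power one by (rule relation) (simp add: dihedral_relations_def)
  then have X_n: "?X [^]\<^bsub>?G\<^esub> int n = \<one>\<^bsub>?G\<^esub>" by (simp add: int_pow_int)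
  have nat_order: "n dvd m" if "?X [^]\<^bsub>?G\<^esub> m = \<one>\<^bsub>?G\<^esub>" for m :: nat
  proof -
    have "word_equiv (dihedral_relations n) (replicate m (Gen_x, True)) []"
      using that by (simp add: power one word_class_eq_iff)
    from word_equiv_imp_word_action_cong[OF this, of 0] have "[int m = 0] (mod int n)"
      by (simp add: word_action_x_power) (simp add: word_action_def)
    then show ?thesis by (simp add: cong_0_iff)
  qed
  interpret dihedral_pair ?G ?X ?Y
  proof unfold_locales
    show "?X \<in> carrier ?G" "?Y \<in> carrier ?G" by (rule closed)+
    have "?c (replicate 2 (Gen_y, True)) = ?c []" by (rule relation) (simp add: dihedral_relations_def)
    then show "?Y \<otimes>\<^bsub>?G\<^esub> ?Y = \<one>\<^bsub>?G\<^esub>" by (simp add: mult one numeral_2_eq_2)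
    have "?c [(Gen_y, True), (Gen_x, True), (Gen_y, False)] = ?c [(Gen_x, False)]"
      by (rule relation) (simp add: dihedral_relations_def)
    then show "?Y \<otimes>\<^bsub>?G\<^esub> ?X \<otimes>\<^bsub>?G\<^esub> inv\<^bsub>?G\<^esub> ?Y = inv\<^bsub>?G\<^esub> ?X" by (simp add: mult inverse)
  qed
  show ?thesis
  proof unfold_locales
    show "0 < n" by fact
    show "rot i = \<one>\<^bsub>?G\<^esub> \<longleftrightarrow> int n dvd i" for i
    proof
      assume "int n dvd i"
      then obtain q where "i = int n * q" by (rule dvdE)
      then show "rot i = \<one>\<^bsub>?G\<^esub>"
        using X_n unfolding rot_def by (simp flip: int_pow_pow)
    next
      assume "rot i = \<one>\<^bsub>?G\<^esub>"
      then have "?X [^]\<^bsub>?G\<^esub> nat \<bar>i\<bar> = \<one>\<^bsub>?G\<^esub>"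
        using int_pow_neg[OF x_closed, of i] unfolding rot_def
        by (cases "i \<ge> 0") (simp_all flip: int_pow_int)
      then show "int n dvd i" using nat_order by fastforce
    qed
    have "?c [(Gen_x, True)] = rot 1" by (simp add: rot_def)
    moreover have "?c [(Gen_x, False)] = rot (- 1)"
      using inverse[of Gen_x True] by (simp add: rot_def int_pow_neg)
    moreover have "?c [(Gen_y, True)] = ref 0" by (simp add: ref_def)
    moreover have "?c [(Gen_y, False)] = ref 0"
    proof -
      have "?c [(Gen_y, False)] = inv\<^bsub>?G\<^esub> ?Y" using inverse[of Gen_y True] by simp
      also have "\<dots> = ref 0" by (simp add: inv_y ref_def)
      finally show ?thesis .
    qed
    ultimately have letter: "?c [p] \<in> range rot \<union> range ref" for p
      by (cases p, cases "fst p"; cases "snd p") auto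
    have "?c w \<in> range rot \<union> range ref" for w
    proof (induction w)
      case Nil
      show ?case unfolding one[symmetric] rot_zero[symmetric] by blast
    next
      case (Cons p w)
      have "?c (p # w) = ?c [p] \<otimes>\<^bsub>?G\<^esub> ?c w" using mult[of "[p]" w] by simp
      moreover have "a \<otimes>\<^bsub>?G\<^esub> b \<in> range rot \<union> range ref"
        if "a \<in> range rot \<union> range ref" "b \<in> range rot \<union> range ref" for a b
        using that by auto
      ultimately show ?case using letter Cons by metis
    qed
    then show "carrier ?G = range rot \<union> range ref"
      using rot_closed ref_closed by (auto simp: G carrier_presented_group)
  qed
qed

theorem theorem5p3:
  fixes n :: nat
  assumes "n \<ge> 3" and "\<not> (\<exists>k. n = 2 ^ k)"
  shows "cograph (NCC_graph (dihedral_group n))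
    \<and> chordal (NCC_graph (dihedral_group n))
    \<and> (even n \<and> odd (n div 2) \<longrightarrow>
         \<not> split_graph (NCC_graph (dihedral_group n))
       \<and> \<not> threshold_graph (NCC_graph (dihedral_group n)))"
proof -
  interpret dihedral "dihedral_group n" "word_class (dihedral_relations n) [(Gen_x, True)]"
    "word_class (dihedral_relations n) [(Gen_y, True)]" n
    using assms(1) by (intro dihedral_dihedral_group) simp
  show ?thesis
    using cograph_NCC_graph chordal_NCC_graph has_induced_two_K2_NCC_graph[OF assms(1)]
    unfolding split_graph_def threshold_graph_def by blast
qed

end
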